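(* Let $s\geq 3$ be an odd integer. Then (i) if $m\geq 2$ is even and $n\geq \frac{sm}{2}(sm-2)$, then $R(P_n,J_{s,m})=2n-1$; (ii) if $m\geq 3$ is odd and $n\geq \frac{sm-1}{2}(sm-1)$, then $R(P_n,J_{s,m})=2n$.
   Context: All graphs are finite and simple. For graphs $G$ and $H$, the Ramsey number $R(G,H)$ is the least natural number $N$ such that for every graph $F$ on $N$ vertices, either $F$ contains $G$ as a subgraph or the complement $\overline{F}$ contains $H$ as a subgraph. $P_n$ denotes the path on $n$ vertices. For integers $s,m\geq 2$, the generalized Jahangir graph $J_{s,m}$ is the graph on $sm+1$ vertices consisting of a cycle $C_{sm}=v_1v_2\cdots v_{sm}v_1$ together with one additional vertex adjacent to exactly the $m$ cycle vertices $v_1, v_{s+1}, v_{2s+1},\ldots,v_{(m-1)s+1}$ (i.e., $m$ vertices of the cycle at distance $s$ from each other along the cycle). *)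

theory Defs
  imports Main
begin

text \<open>A (finite simple) graph is given by a vertex count k (vertices 0..<k) and an
  adjacency predicate; only its restriction to distinct vertices below k matters.\<close>

definition simple_graph :: "nat \<Rightarrow> (nat \<Rightarrow> nat \<Rightarrow> bool) \<Rightarrow> bool" where
  "simple_graph N E \<longleftrightarrow> (\<forall>u v. E u v \<longrightarrow> u < N \<and> v < N \<and> u \<noteq> v \<and> E v u)"

definition contains :: "nat \<Rightarrow> (nat \<Rightarrow> nat \<Rightarrow> bool) \<Rightarrow> nat \<Rightarrow> (nat \<Rightarrow> nat \<Rightarrow> bool) \<Rightarrow> bool" where
  "contains N E k HE \<longleftrightarrow> (\<exists>f. inj_on f {0..<k} \<and> f ` {0..<k} \<subseteq> {0..<N} \<and>
      (\<forall>u<k. \<forall>v<k. HE u v \<longrightarrow> E (f u) (f v)))"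

definition complement :: "nat \<Rightarrow> (nat \<Rightarrow> nat \<Rightarrow> bool) \<Rightarrow> nat \<Rightarrow> nat \<Rightarrow> bool" where
  "complement N E u v \<longleftrightarrow> u < N \<and> v < N \<and> u \<noteq> v \<and> \<not> E u v"

definition ramsey :: "nat \<Rightarrow> (nat \<Rightarrow> nat \<Rightarrow> bool) \<Rightarrow> nat \<Rightarrow> (nat \<Rightarrow> nat \<Rightarrow> bool) \<Rightarrow> nat" where
  "ramsey kG GE kH HE = (LEAST N. \<forall>E. simple_graph N E \<longrightarrow>
      contains N E kG GE \<or> contains N (complement N E) kH HE)"

definition path_edges :: "nat \<Rightarrow> nat \<Rightarrow> nat \<Rightarrow> bool" where
  "path_edges n u v \<longleftrightarrow> u < n \<and> v < n \<and> (v = u + 1 \<or> u = v + 1)"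

text \<open>Generalized Jahangir graph J_{s,m} on vertices 0..sm: cycle vertex v_{i+1} is i
  (i < sm), the extra vertex is sm, adjacent to i with s dvd i.\<close>
definition jahangir_edges :: "nat \<Rightarrow> nat \<Rightarrow> nat \<Rightarrow> nat \<Rightarrow> bool" where
  "jahangir_edges s m u v \<longleftrightarrow>
     (u < s*m \<and> v < s*m \<and> (v = (u + 1) mod (s*m) \<or> u = (v + 1) mod (s*m))) \<or>
     (u = s*m \<and> v < s*m \<and> s dvd v) \<or> (v = s*m \<and> u < s*m \<and> s dvd u)"

end

theory Submission
  imports Defs
begin

text \<open>
  Upper bounds: depth-first search in a graph without an \<open>n\<close>-vertex path yields two large vertex sets
  \<open>S\<close>, \<open>T\<close> with no edges between them; take such a pair maximal. Call a vertex a hub if it has at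
  least \<open>q\<close>, about \<open>sm/2\<close>, non-neighbours in \<open>S\<close> and in \<open>T\<close>. For even \<open>sm\<close> a hub gives a whole
  wheel in the complement. Without hubs, \<open>S\<close> and \<open>T\<close> are nearly complete and so have Hamiltonian paths
  from every vertex; a vertex outside, being adjacent to both by maximality, would join these into a
  path with at least \<open>n\<close> vertices, so \<open>S \<union> T\<close> is everything and one side has at least \<open>n\<close> vertices.
  For odd \<open>sm\<close> a hub \<open>x\<close> together with a non-adjacent pair inside \<open>S - {x}\<close> or \<open>T - {x}\<close> suffices
  for the Jahangir graph. Otherwise \<open>S - {x}\<close> and \<open>T - {x}\<close> are cliques; if \<open>x \<in> S\<close>, then no edges
  join \<open>S - {x}\<close> to the complement of \<open>S\<close>, and one of these two sets, which together have \<open>2n - 1\<close>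
  vertices, contains a path on \<open>n\<close> vertices.

  Lower bounds: two disjoint cliques on \<open>n - 1\<close> vertices, with an additional isolated vertex for odd
  \<open>m\<close>.
\<close>

section \<open>Set pairs without edges between them, hubs, and paths\<close>

definition nonnbrs :: "('a \<Rightarrow> 'a \<Rightarrow> bool) \<Rightarrow> 'a \<Rightarrow> 'a set \<Rightarrow> 'a set" where
  "nonnbrs E x A = {v \<in> A. v \<noteq> x \<and> \<not> E x v}"

text \<open>In the complement a hub can serve as the centre of the Jahangir graph, with at least
  \<open>q\<close> candidates for cycle vertices on each side.\<close>

definition hub :: "('a \<Rightarrow> 'a \<Rightarrow> bool) \<Rightarrow> nat \<Rightarrow> 'a set \<Rightarrow> 'a set \<Rightarrow> 'a \<Rightarrow> bool" where
  "hub E q S T x \<longleftrightarrow> q \<le> card (nonnbrs E x S) \<and> q \<le> card (nonnbrs E x T)"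

text \<open>In the complement of a symmetric \<open>E\<close> the two sets span a complete bipartite
  graph, the source of all cycle edges but at most one.\<close>

definition cross_free :: "('a \<Rightarrow> 'a \<Rightarrow> bool) \<Rightarrow> 'a set \<Rightarrow> 'a set \<Rightarrow> bool" where
  "cross_free E S T \<longleftrightarrow> S \<inter> T = {} \<and> (\<forall>a\<in>S. \<forall>b\<in>T. \<not> E a b)"

definition path_in :: "('a \<Rightarrow> 'a \<Rightarrow> bool) \<Rightarrow> 'a set \<Rightarrow> 'a list \<Rightarrow> bool" where
  "path_in E A xs \<longleftrightarrow> distinct xs \<and> set xs \<subseteq> A \<and> successively E xs"

lemma cross_free_commute: "symp E \<Longrightarrow> cross_free E S T \<Longrightarrow> cross_free E T S"
  unfolding cross_free_def by (auto dest: sympD)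

lemma nonnbrs_cross_free: "cross_free E S T \<Longrightarrow> x \<in> S \<Longrightarrow> nonnbrs E x T = T"
  unfolding cross_free_def nonnbrs_def by auto

section \<open>Longest paths and depth-first search\<close>

lemma successively_rev_symp: "symp E \<Longrightarrow> successively E (rev xs) = successively E xs"
proof -
  assume "symp E"
  then have "(\<lambda>x y. E y x) = E" by (auto simp: fun_eq_iff dest: sympD)
  then show ?thesis by (simp only: successively_rev)
qed

lemma path_in_length_le: "finite A \<Longrightarrow> path_in E A xs \<Longrightarrow> length xs \<le> card A"
  unfolding path_in_def by (metis card_mono distinct_card)

text \<open>Posa rotation: in a longest path from \<open>v\<close>, every neighbour \<open>p\<^sub>i\<close> of the last vertex turns
  \<open>p\<^sub>i\<^sub>+\<^sub>1\<close> into the last vertex of another longest path, so an unvisited vertex misses all of them.\<close>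
lemma hamiltonian_path_from:
  assumes sym: "symp E" and fin: "finite S" and v: "v \<in> S"
    and few: "\<And>x. x \<in> S \<Longrightarrow> card (nonnbrs E x S) < q" and big: "2 * q \<le> card S"
  obtains xs where "path_in E S xs" "set xs = S" "xs \<noteq> []" "hd xs = v"
proof -
  define P where "P xs \<longleftrightarrow> path_in E S xs \<and> xs \<noteq> [] \<and> hd xs = v" for xs
  have "P [v]" using v by (simp add: P_def path_in_def)
  moreover have "\<forall>xs. P xs \<longrightarrow> length xs \<le> card S"
    using path_in_length_le[OF fin] by (auto simp: P_def)
  ultimately obtain xs where xs: "P xs" and max: "\<And>ys. P ys \<Longrightarrow> length ys \<le> length xs"
    using ex_has_greatest_nat[of P "[v]" length "Suc (card S)"] by (auto simp: less_Suc_eq_le)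
  have d: "distinct xs" "set xs \<subseteq> S" "successively E xs" "xs \<noteq> []" "hd xs = v"
    using xs by (auto simp: P_def path_in_def)
  have "set xs = S"
  proof (rule ccontr)
    assume "set xs \<noteq> S"
    then obtain w where w: "w \<in> S" "w \<notin> set xs" using d by auto
    \<comment> \<open>Stated for every path on the same vertices, since it is applied to the
      rotations of \<open>xs\<close> as well.\<close>
    have ext: "\<not> E (last ys) w" if "P ys" "set ys = set xs" "length ys = length xs" for ys
    proof
      assume "E (last ys) w"
      then have "P (ys @ [w])" using that w
        by (auto simp: P_def path_in_def successively_append_iff)
      then show False using max[of "ys @ [w]"] that by simp
    qed
    let ?l = "last xs"
    define I where "I = {i. Suc i < length xs \<and> E ?l (xs ! i)}"
    have lS: "?l \<in> S" using d by auto
    have rot: "xs ! Suc i \<in> nonnbrs E w S" if "i \<in> I" for i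
    proof -
      have i: "Suc i < length xs" and e: "E ?l (xs ! i)" using that by (auto simp: I_def)
      define a b where "a = take (Suc i) xs" and "b = drop (Suc i) xs"
      have ab: "xs = a @ b" "a \<noteq> []" "b \<noteq> []" using i d by (auto simp: a_def b_def)
      have la: "last a = xs ! i" using i by (simp add: a_def take_Suc_conv_app_nth)
      have lb: "last b = ?l" using ab by simp
      have hb: "hd b = xs ! Suc i" using i by (simp add: b_def hd_drop_conv_nth)
      have sab: "successively E a" "successively E b"
        using d(3) ab by (auto simp: successively_append_iff)
      have "E (last a) (last b)" using e la lb sym by (auto dest: sympD)
      then have "successively E (a @ rev b)"
        using sab ab successively_rev_symp[OF sym, of b]
        by (simp add: successively_append_iff hd_rev del: successively_rev)
      then have "P (a @ rev b)" using d ab by (auto simp: P_def path_in_def)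
      then have "\<not> E (last (a @ rev b)) w" by (rule ext) (use ab in auto)
      then have "\<not> E (xs ! Suc i) w" using ab hb by (simp add: last_rev)
      then show ?thesis using i d w sym by (auto simp: nonnbrs_def dest: sympD)
    qed
    have "{x \<in> S. E ?l x \<and> x \<noteq> ?l} \<subseteq> (\<lambda>i. xs ! i) ` I"
    proof
      fix x assume "x \<in> {x \<in> S. E ?l x \<and> x \<noteq> ?l}"
      then have x: "x \<in> S" "E ?l x" "x \<noteq> ?l" by auto
      have "x \<in> set xs"
      proof (rule ccontr)
        assume "x \<notin> set xs"
        then have "P (xs @ [x])" using x xs
          by (auto simp: P_def path_in_def successively_append_iff)
        then show False using max[of "xs @ [x]"] by simp
      qed
      then obtain i where i: "i < length xs" "xs ! i = x" by (auto simp: in_set_conv_nth)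
      have "i \<noteq> length xs - 1" using i x d by (auto simp: last_conv_nth)
      then show "x \<in> (\<lambda>i. xs ! i) ` I" using i x by (auto simp: I_def)
    qed
    moreover have finI: "finite I" by (rule finite_subset[of _ "{..<length xs}"]) (auto simp: I_def)
    ultimately have "card {x \<in> S. E ?l x \<and> x \<noteq> ?l} \<le> card I"
      by (meson card_image_le card_mono finite_imageI le_trans)
    moreover have "card I \<le> card (nonnbrs E w S)"
    proof (rule card_inj_on_le)
      show "inj_on (\<lambda>i. xs ! Suc i) I" using d by (auto simp: inj_on_def I_def nth_eq_iff_index_eq)
      show "(\<lambda>i. xs ! Suc i) ` I \<subseteq> nonnbrs E w S" using rot by auto
      show "finite (nonnbrs E w S)" using fin by (simp add: nonnbrs_def)
    qed
    moreover have "card S = card {x \<in> S. E ?l x \<and> x \<noteq> ?l} + card (nonnbrs E ?l S) + 1"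
    proof -
      have "S = insert ?l ({x \<in> S. E ?l x \<and> x \<noteq> ?l} \<union> nonnbrs E ?l S)"
        using lS by (auto simp: nonnbrs_def)
      then have "card S = card (insert ?l ({x \<in> S. E ?l x \<and> x \<noteq> ?l} \<union> nonnbrs E ?l S))" by simp
      also have "\<dots> = Suc (card ({x \<in> S. E ?l x \<and> x \<noteq> ?l} \<union> nonnbrs E ?l S))"
        using fin by (subst card_insert_disjoint) (auto simp: nonnbrs_def)
      also have "card ({x \<in> S. E ?l x \<and> x \<noteq> ?l} \<union> nonnbrs E ?l S)
          = card {x \<in> S. E ?l x \<and> x \<noteq> ?l} + card (nonnbrs E ?l S)"
        using fin by (intro card_Un_disjoint) (auto simp: nonnbrs_def)
      finally show ?thesis by simp
    qed
    \<comment> \<open>The neighbours of the last vertex number at most \<open>q - 1\<close> by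
      rotation, its non-neighbours at most \<open>q - 1\<close> by \<open>few\<close>; with the
      vertex itself this gives at most \<open>2 * q - 1\<close> vertices in
      \<open>S\<close>.\<close>
    ultimately show False using few[OF lS] few[OF w(1)] big by linarith
  qed
  then show ?thesis using that[of xs] d by (auto simp: path_in_def)
qed

text \<open>Depth-first search: \<open>S\<close> is the set of finished vertices, \<open>T\<close> the set of unvisited ones, and
  the stack is a path. Each step lowers \<open>card T - card S\<close> by one.\<close>
lemma dfs_state:
  assumes sym: "symp E" and fin: "finite V" and d: "d \<le> card V"
  shows "\<exists>S T xs. cross_free E S T \<and> path_in E V xs \<and> S \<union> T \<union> set xs = V \<and>
    set xs \<inter> (S \<union> T) = {} \<and> card T = card S + (card V - d)"
  using d
proof (induction d)
  case 0
  show ?case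
    by (rule exI[of _ "{}"], rule exI[of _ V], rule exI[of _ "[]"])
      (simp add: cross_free_def path_in_def)
next
  case (Suc d)
  then obtain S T xs where *: "cross_free E S T" "path_in E V xs" "S \<union> T \<union> set xs = V"
    "set xs \<inter> (S \<union> T) = {}" "card T = card S + (card V - d)" by auto
  have fST: "finite S" "finite T" using *(3) fin by (auto intro: finite_subset)
  have T0: "T \<noteq> {}" using *(5) Suc.prems by auto
  \<comment> \<open>If the top of the stack has no unvisited neighbour, it can be moved to
    \<open>S\<close> without creating an edge between \<open>S\<close> and \<open>T\<close>.\<close>
  consider (push) t where "t \<in> T" "xs = [] \<or> E (last xs) t"
    | (pop) "xs \<noteq> []" "\<forall>t\<in>T. \<not> E (last xs) t" using T0 by blast
  then show ?case
  proof cases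
    case push
    have "cross_free E S (T - {t})" using *(1) by (auto simp: cross_free_def)
    moreover have "path_in E V (xs @ [t])"
      using *(2-4) push by (auto simp: path_in_def successively_append_iff)
    moreover have "S \<union> (T - {t}) \<union> set (xs @ [t]) = V" using *(3) push by auto
    moreover have "set (xs @ [t]) \<inter> (S \<union> (T - {t})) = {}"
      using *(1,4) push by (auto simp: cross_free_def)
    moreover have "card (T - {t}) = card S + (card V - Suc d)"
      using *(5) push fST Suc.prems by simp
    ultimately show ?thesis by blast
  next
    case pop
    then obtain ys l where ys: "xs = ys @ [l]" by (metis append_butlast_last_id)
    have "cross_free E (insert l S) T" using *(1,4) pop ys by (auto simp: cross_free_def)
    moreover have "path_in E V ys"
      using *(2) ys by (auto simp: path_in_def successively_append_iff)
    moreover have "insert l S \<union> T \<union> set ys = V" using *(3) ys by auto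
    moreover have "set ys \<inter> (insert l S \<union> T) = {}" using *(2,4) ys by (auto simp: path_in_def)
    moreover have "card T = card (insert l S) + (card V - Suc d)"
      using *(4,5) ys fST Suc.prems by auto
    ultimately show ?thesis by blast
  qed
qed

section \<open>Structure of graphs without a path on \<open>n\<close> vertices\<close>

locale path_free =
  fixes E :: "'a \<Rightarrow> 'a \<Rightarrow> bool" and V :: "'a set" and n :: nat
  assumes sym: "symp E" and finV: "finite V"
    and short: "\<And>xs. path_in E V xs \<Longrightarrow> length xs < n"
begin

text \<open>After \<open>card V\<close> steps of the search the two sets have equal size, and the
  stack, being a path, holds fewer than \<open>n\<close> vertices.\<close>

lemma balanced_cross_free:
  obtains S T where "cross_free E S T" "S \<subseteq> V" "T \<subseteq> V" "card S = card T"
    "card V < n + 2 * card S"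
proof -
  obtain S T xs where *: "cross_free E S T" "path_in E V xs" "S \<union> T \<union> set xs = V"
    "set xs \<inter> (S \<union> T) = {}" "card T = card S"
    using dfs_state[OF sym finV order.refl] by auto
  have f: "finite S" "finite T" using *(3) finV by (auto intro: finite_subset)
  have "card V \<le> card (S \<union> T) + card (set xs)" using *(3) by (metis card_Un_le)
  also have "card (S \<union> T) = card S + card T"
    using *(1) f by (simp add: card_Un_disjoint cross_free_def)
  also have "card (set xs) \<le> length xs" by (rule card_length)
  also have "length xs < n" by (rule short[OF *(2)])
  finally show ?thesis using that[of S T] * by auto
qed

text \<open>Take a pair of largest total size among those with at least \<open>c\<close> vertices on
  each side. An outside vertex without neighbours in one set could be added to the other.\<close>

lemma maximal_cross_free:
  assumes "2 * c + n \<le> card V + 2"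
  obtains S T where "cross_free E S T" "S \<subseteq> V" "T \<subseteq> V" "c \<le> card S" "c \<le> card T"
    "card V < n + card S + card T"
    "\<And>u. u \<in> V - (S \<union> T) \<Longrightarrow> (\<exists>a\<in>S. E u a) \<and> (\<exists>b\<in>T. E u b)"
proof -
  define P where "P = (\<lambda>(S, T). cross_free E S T \<and> S \<subseteq> V \<and> T \<subseteq> V \<and> c \<le> card S \<and> c \<le> card T)"
  obtain S0 T0 where 0: "cross_free E S0 T0" "S0 \<subseteq> V" "T0 \<subseteq> V" "card S0 = card T0"
    "card V < n + 2 * card S0" by (rule balanced_cross_free)
  \<comment> \<open>The size hypothesis and the bound on \<open>card V\<close> give
    \<open>2 * c \<le> 2 * card S0 + 1\<close>, hence \<open>c \<le> card S0\<close>.\<close>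
  have P0: "P (S0, T0)" using 0 assms by (auto simp: P_def)
  have "card S \<le> card V" if "S \<subseteq> V" for S using card_mono[OF finV that] .
  then have "\<forall>p. P p \<longrightarrow> (\<lambda>(S, T). card S + card T) p < Suc (card V + card V)"
    by (auto simp: P_def less_Suc_eq_le intro!: add_mono)
  then obtain p where p: "P p"
    and max: "\<And>p'. P p' \<Longrightarrow> (\<lambda>(S, T). card S + card T) p' \<le> (\<lambda>(S, T). card S + card T) p"
    using ex_has_greatest_nat[of P "(S0, T0)" "\<lambda>(S, T). card S + card T" "Suc (card V + card V)"] P0 by blast
  obtain S T where pST: "p = (S, T)" by (cases p)
  have ST: "cross_free E S T" "S \<subseteq> V" "T \<subseteq> V" "c \<le> card S" "c \<le> card T"
    using p by (auto simp: P_def pST)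
  have f: "finite S" "finite T" using ST finV by (auto intro: finite_subset)
  have "(\<exists>a\<in>S. E u a) \<and> (\<exists>b\<in>T. E u b)" if u: "u \<in> V - (S \<union> T)" for u
  proof (rule ccontr)
    assume "\<not> ?thesis"
    then have "P (insert u S, T) \<or> P (S, insert u T)"
      using ST u f sym by (auto simp: P_def cross_free_def dest: sympD)
    then show False using max[of "(insert u S, T)"] max[of "(S, insert u T)"] u f
      by (auto simp: pST)
  qed
  moreover have "card V < n + card S + card T" using max[OF P0] 0 by (simp add: pST)
  ultimately show ?thesis using that[OF ST] by blast
qed

lemma near_complete_card_less:
  assumes "S \<subseteq> V" "\<And>x. x \<in> S \<Longrightarrow> card (nonnbrs E x S) < q" "2 * q \<le> card S" "S \<noteq> {}"
  shows "card S < n"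
proof -
  have f: "finite S" using assms finV by (auto intro: finite_subset)
  obtain v where v: "v \<in> S" using assms by auto
  obtain xs where xs: "path_in E S xs" "set xs = S"
    using hamiltonian_path_from[OF sym f v assms(2,3)] by metis
  have "path_in E V xs" using xs assms by (auto simp: path_in_def)
  then show ?thesis using short[of xs] xs by (metis distinct_card path_in_def)
qed

text \<open>A Hamiltonian path of \<open>S\<close> ending in \<open>a\<close>, then
  \<open>u\<close>, then a Hamiltonian path of \<open>T\<close> starting in \<open>b\<close> would
  have at least \<open>n\<close> vertices.\<close>

lemma no_bridge:
  assumes "S \<subseteq> V" "\<And>x. x \<in> S \<Longrightarrow> card (nonnbrs E x S) < q" "2 * q \<le> card S"
    and "T \<subseteq> V" "\<And>x. x \<in> T \<Longrightarrow> card (nonnbrs E x T) < r" "2 * r \<le> card T"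
    and "S \<inter> T = {}" "n \<le> Suc (card S + card T)"
    and "u \<in> V - (S \<union> T)" "a \<in> S" "b \<in> T" "E u a" "E u b"
  shows False
proof -
  have f: "finite S" "finite T" using assms finV by (auto intro: finite_subset)
  obtain xs where xs: "path_in E S xs" "set xs = S" "xs \<noteq> []" "hd xs = a"
    using hamiltonian_path_from[OF sym f(1) \<open>a \<in> S\<close> assms(2,3)] by blast
  obtain ys where ys: "path_in E T ys" "set ys = T" "ys \<noteq> []" "hd ys = b"
    using hamiltonian_path_from[OF sym f(2) \<open>b \<in> T\<close> assms(5,6)] by blast
  have "E a u" using assms sym by (auto dest: sympD)
  moreover have "successively E (rev xs)"
    using xs by (simp only: successively_rev_symp[OF sym] path_in_def)
  ultimately have "path_in E V (rev xs @ u # ys)"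
    using xs ys assms
    by (auto simp: path_in_def successively_append_iff last_rev successively_Cons
        simp del: successively_rev)
  then have "length xs + Suc (length ys) < n" using short by fastforce
  moreover have "length xs = card S" "length ys = card T"
    using xs ys by (metis distinct_card path_in_def)+
  ultimately show False using assms by linarith
qed

text \<open>If the sides exhaust \<open>V\<close>, each has at most \<open>n - 1\<close> vertices,
  too few in total. Otherwise an outside vertex bridges them; the two inequalities
  \<open>big\<close> yield \<open>n \<le> card S + card T\<close>, so the resulting path is too
  long.\<close>

lemma two_near_complete_sides:
  assumes "cross_free E S T" "S \<subseteq> V" "T \<subseteq> V" "0 < q" "2 * q \<le> card S" "2 * q \<le> card T"
    and big: "card V < n + card S + card T" "2 * n \<le> Suc (card V)"
    and adj: "\<And>u. u \<in> V - (S \<union> T) \<Longrightarrow> (\<exists>a\<in>S. E u a) \<and> (\<exists>b\<in>T. E u b)"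
    and S: "\<And>x. x \<in> S \<Longrightarrow> card (nonnbrs E x S) < q"
    and T: "\<And>x. x \<in> T \<Longrightarrow> card (nonnbrs E x T) < q"
  shows False
proof (cases "V = S \<union> T")
  case True
  have "card S < n" "card T < n"
    using near_complete_card_less[of S q] near_complete_card_less[of T q] assms by force+
  moreover have "card V \<le> card S + card T" using True by (simp add: card_Un_le)
  ultimately show False using big by linarith
next
  case False
  then obtain u where u: "u \<in> V - (S \<union> T)" using assms by auto
  obtain a b where "a \<in> S" "E u a" "b \<in> T" "E u b" using adj[OF u] by auto
  then show False
    using no_bridge[OF \<open>S \<subseteq> V\<close> S _ \<open>T \<subseteq> V\<close> T, of u a b] u assms
    by (auto simp: cross_free_def)
qed

text \<open>A vertex of \<open>S\<close> misses all of \<open>T\<close>, so it fails to be a hub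
  only by having fewer than \<open>q\<close> non-neighbours in \<open>S\<close>; likewise for
  \<open>T\<close>. Without hubs both sides are therefore nearly complete.\<close>

lemma hub_exists:
  assumes c: "4 * q + n \<le> card V + 2" and q: "0 < q" and N: "2 * n \<le> Suc (card V)"
  obtains S T x where "cross_free E S T" "S \<subseteq> V" "T \<subseteq> V" "x \<in> V" "hub E q S T x"
proof -
  obtain S T where ST: "cross_free E S T" "S \<subseteq> V" "T \<subseteq> V" "2 * q \<le> card S" "2 * q \<le> card T"
    "card V < n + card S + card T"
    and adj: "\<And>u. u \<in> V - (S \<union> T) \<Longrightarrow> (\<exists>a\<in>S. E u a) \<and> (\<exists>b\<in>T. E u b)"
    using maximal_cross_free[of "2 * q"] c by auto
  have "\<exists>x\<in>S \<union> T. hub E q S T x"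
  proof (rule ccontr)
    assume no: "\<not> ?thesis"
    have "card (nonnbrs E x S) < q" if "x \<in> S" for x
    proof -
      have "\<not> hub E q S T x" using no that by blast
      then show ?thesis using nonnbrs_cross_free[OF ST(1) that] ST(5) by (auto simp: hub_def)
    qed
    moreover have "card (nonnbrs E x T) < q" if "x \<in> T" for x
    proof -
      have "\<not> hub E q S T x" using no that by blast
      then show ?thesis using nonnbrs_cross_free[OF cross_free_commute[OF sym ST(1)] that] ST(4)
        by (auto simp: hub_def)
    qed
    ultimately show False using two_near_complete_sides[OF ST(1-3) q ST(4-6) N adj] by blast
  qed
  then show ?thesis using that ST by blast
qed

text \<open>The negated claim concerns all cross-free pairs, so it can be used first for a maximal
  pair and then for the pair \<open>S - {x}\<close>, \<open>V - S\<close> derived from it. The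
  summand 2 provides one spare vertex per side, to allow for the removal of
  \<open>x\<close>.\<close>

lemma hub_with_nonadjacent_pair:
  assumes c: "4 * q + 2 + n \<le> card V + 2" and q: "0 < q" and N: "2 * n \<le> card V"
  obtains S T x y z where "cross_free E S T" "S \<subseteq> V" "T \<subseteq> V" "x \<in> V" "hub E q S T x"
    "y \<in> S - {x}" "z \<in> S - {x}" "y \<noteq> z" "\<not> E y z"
proof (rule ccontr)
  assume contra: "\<not> thesis"
  note found = that
  have clique1: "E y z"
    if "cross_free E S T" "S \<subseteq> V" "T \<subseteq> V" "x \<in> V" "hub E q S T x"
      "y \<in> S - {x}" "z \<in> S - {x}" "y \<noteq> z" for S T x y z
    using contra found[OF that] by blast
  have clique2: "E y z"
    if "cross_free E S T" "S \<subseteq> V" "T \<subseteq> V" "x \<in> V" "hub E q S T x"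
      "y \<in> T - {x}" "z \<in> T - {x}" "y \<noteq> z" for S T x y z
    using clique1[OF cross_free_commute[OF sym that(1)]] that by (auto simp: hub_def)
  \<comment> \<open>Cliques count as nearly complete sets with threshold 1.\<close>
  have complete: "card (nonnbrs E y A) < 1"
    if "\<And>y z. y \<in> A \<Longrightarrow> z \<in> A \<Longrightarrow> y \<noteq> z \<Longrightarrow> E y z" "y \<in> A" for y A
  proof -
    have "nonnbrs E y A = {}" using that by (auto simp: nonnbrs_def)
    then show ?thesis by simp
  qed
  have main: False
    if ST: "cross_free E S T" "S \<subseteq> V" "T \<subseteq> V" "Suc (2 * q) \<le> card S" "Suc (2 * q) \<le> card T"
    "card V < n + card S + card T"
    and adj: "\<And>u. u \<in> V - (S \<union> T) \<Longrightarrow> (\<exists>a\<in>S. E u a) \<and> (\<exists>b\<in>T. E u b)"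
    and x: "x \<in> S" "hub E q S T x" for S T x
  proof -
    \<comment> \<open>The aim is \<open>card S' < n\<close> and \<open>card B < n\<close>; together
      with \<open>x\<close> this leaves at most \<open>2 * n - 1\<close> vertices in
      \<open>V\<close>.\<close>
    define S' B where "S' = S - {x}" and "B = V - S"
    have f: "finite S" "finite T" "finite B"
      using ST finV by (auto intro: finite_subset simp: B_def)
    have cS: "card S' = card S - 1" using x f by (simp add: S'_def)
    have TB: "T \<subseteq> B" using ST by (auto simp: B_def cross_free_def)
    have xV: "x \<in> V" using x ST by auto
    have S'c: "E y z" if "y \<in> S'" "z \<in> S'" "y \<noteq> z" for y z
      using clique1[OF ST(1-3) xV x(2)] that by (auto simp: S'_def)
    have Tc: "E y z" if "y \<in> T" "z \<in> T" "y \<noteq> z" for y z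
      using clique2[OF ST(1-3) xV x(2)] that x ST(1) by (auto simp: cross_free_def)
    have S'V: "S' \<subseteq> V" and BV: "B \<subseteq> V" using ST by (auto simp: S'_def B_def)
    \<comment> \<open>A vertex outside \<open>S \<union> T\<close> has a neighbour in
      \<open>T\<close> by maximality; a neighbour in \<open>S'\<close> too would make it a bridge
      between two cliques.\<close>
    have no_edge: "\<not> E a u" if "a \<in> S'" "u \<in> B" for a u
    proof (cases "u \<in> T")
      case True
      then show ?thesis using that ST(1) by (auto simp: cross_free_def S'_def)
    next
      case False
      then have u: "u \<in> V - (S \<union> T)" using that by (auto simp: B_def)
      then obtain b where b: "b \<in> T" "E u b" using adj by blast
      show ?thesis
      proof
        assume "E a u"
        then have "E u a" using sym by (auto dest: sympD)
        moreover have "S' \<inter> T = {}" using ST(1) by (auto simp: cross_free_def S'_def)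
        moreover have "u \<in> V - (S' \<union> T)" using u by (auto simp: S'_def)
        moreover have "2 * 1 \<le> card S'" "2 * 1 \<le> card T" "n \<le> Suc (card S' + card T)"
          using cS ST(4-6) q N by linarith+
        ultimately show False
          using no_bridge[OF S'V complete[of S', OF S'c] _ ST(3) complete[of T, OF Tc]] that b
          by blast
      qed
    qed
    have cf: "cross_free E S' B" using no_edge by (auto simp: cross_free_def S'_def B_def)
    have "card S' < n"
      using near_complete_card_less[OF S'V complete[of S', OF S'c]] cS ST(4) q
      by (cases "S' = {}") auto
    moreover have "card B < n"
    \<comment> \<open>If the new pair has a hub \<open>b\<close> in \<open>B\<close>, then
      \<open>B - {b}\<close> is a clique, and a neighbour \<open>t\<close> of \<open>b\<close> lets
      a Hamiltonian path of it be prolonged to \<open>b\<close>. If not, \<open>B\<close> itself is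
      nearly complete, because its vertices miss all of \<open>S'\<close>.\<close>
    proof (cases "\<exists>b\<in>B. hub E q S' B b")
      case True
      then obtain b where b: "b \<in> B" "hub E q S' B b" by auto
      have Bc: "E y z" if "y \<in> B - {b}" "z \<in> B - {b}" "y \<noteq> z" for y z
        using clique2[OF cf S'V BV _ b(2)] that b BV by auto
      obtain t where t: "t \<in> B - {b}" "E b t"
      proof (cases "b \<in> T")
        case True
        have "card (T - {b}) \<noteq> 0" using ST(5) q f True by simp
        then have "T - {b} \<noteq> {}" by (metis card.empty)
        then obtain t where "t \<in> T - {b}" by blast
        then show ?thesis using that[of t] Tc[of b t] True TB by auto
      next
        case False
        then have "b \<in> V - (S \<union> T)" using b by (auto simp: B_def)
        then obtain t where "t \<in> T" "E b t" using adj by blast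
        then show ?thesis using that[of t] TB False by auto
      qed
      have "card T \<le> card B" using TB f by (simp add: card_mono)
      then have cB: "2 * 1 \<le> card (B - {b})" using ST(5) q b f by (simp add: card_Diff_singleton)
      have fB: "finite (B - {b})" using f by simp
      obtain xs where xs: "path_in E (B - {b}) xs" "set xs = B - {b}" "xs \<noteq> []" "hd xs = t"
        using hamiltonian_path_from[OF sym fB t(1) complete[of "B - {b}", OF Bc] cB] by blast
      have "path_in E V (b # xs)" using xs b t BV by (auto simp: path_in_def successively_Cons)
      then have "Suc (length xs) < n" using short by fastforce
      moreover have "length xs = card (B - {b})" using xs by (metis distinct_card path_in_def)
      ultimately show ?thesis using b f by simp
    next
      case False
      have few: "card (nonnbrs E b B) < q" if "b \<in> B" for b
      proof -
        have "nonnbrs E b S' = S'"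
          using nonnbrs_cross_free[OF cross_free_commute[OF sym cf] that] .
        then show ?thesis using False that cS ST(4) by (auto simp: hub_def)
      qed
      have "card T \<le> card B" using TB f by (simp add: card_mono)
      then show ?thesis using near_complete_card_less[OF BV few] ST(5) by fastforce
    qed
    moreover have "card V = card S + card B"
      using ST(2) f finV by (simp add: B_def card_Diff_subset card_mono)
    ultimately show False using cS N by linarith
  qed
  obtain S T where ST: "cross_free E S T" "S \<subseteq> V" "T \<subseteq> V" "Suc (2 * q) \<le> card S" "Suc (2 * q) \<le> card T"
    "card V < n + card S + card T"
    and adj: "\<And>u. u \<in> V - (S \<union> T) \<Longrightarrow> (\<exists>a\<in>S. E u a) \<and> (\<exists>b\<in>T. E u b)"
    using maximal_cross_free[of "Suc (2 * q)"] c by auto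
  have TS: "cross_free E T S" by (rule cross_free_commute[OF sym ST(1)])
  have N': "2 * n \<le> Suc (card V)" using N by simp
  have big: "2 * q \<le> card S" "2 * q \<le> card T" using ST by auto
  show False
  proof (cases "\<exists>x\<in>V. hub E q S T x")
    case True
    then obtain x where x: "x \<in> V" "hub E q S T x" by auto
    \<comment> \<open>By \<open>main\<close> and its mirror image a hub lies outside both sides, so
      its removal changes neither and both are cliques.\<close>
    have "x \<notin> S" using main[OF ST adj, of x] x by blast
    moreover have "x \<notin> T"
      using main[OF TS ST(3,2,5,4), of x] adj x ST(6) by (auto simp: hub_def)
    ultimately have "card (nonnbrs E y S) < 1" if "y \<in> S" for y
      using complete[OF clique1[OF ST(1-3) x] that] by auto
    moreover have "card (nonnbrs E y T) < 1" if "y \<in> T" for y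
      using complete[OF clique2[OF ST(1-3) x] that] \<open>x \<notin> T\<close> by auto
    ultimately show False
      using two_near_complete_sides[OF ST(1-3), of 1] big q ST(6) N' adj by auto
  next
    case False
    have "card (nonnbrs E x S) < q" if "x \<in> S" for x
    proof -
      have "\<not> hub E q S T x" using False that ST(2) by blast
      then show ?thesis using nonnbrs_cross_free[OF ST(1) that] big by (auto simp: hub_def)
    qed
    moreover have "card (nonnbrs E x T) < q" if "x \<in> T" for x
    proof -
      have "\<not> hub E q S T x" using False that ST(3) by blast
      then show ?thesis using nonnbrs_cross_free[OF TS that] big by (auto simp: hub_def)
    qed
    ultimately show False using two_near_complete_sides[OF ST(1-3) q big ST(6) N' adj] by blast
  qed
qed

end

section \<open>Embedding paths and Jahangir graphs\<close>

lemma contains_path: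
  assumes "symp E" "path_in E {0..<N} xs" "n \<le> length xs"
  shows "contains N E n (path_edges n)"
  unfolding contains_def
proof (intro exI[of _ "(!) xs"] conjI)
  show "inj_on ((!) xs) {0..<n}"
    using assms by (auto simp: inj_on_def path_in_def nth_eq_iff_index_eq)
  show "(!) xs ` {0..<n} \<subseteq> {0..<N}"
    using assms by (force simp: path_in_def)
  have "E (xs ! i) (xs ! Suc i)" if "Suc i < n" for i
    using assms that by (auto simp: path_in_def successively_conv_nth)
  then show "\<forall>u<n. \<forall>v<n. path_edges n u v \<longrightarrow> E (xs ! u) (xs ! v)"
    using assms(1) by (auto simp: path_edges_def dest: sympD)
qed

text \<open>Reduces an embedding to a cyclic sequence \<open>c\<close> and a centre
  \<open>x\<close>. The bound \<open>2 \<le> s * m\<close> makes cyclically consecutive positions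
  distinct, as adjacency in the complement demands.\<close>

lemma contains_jahangir:
  assumes sym: "symp E" and k: "2 \<le> s * m" and inj: "inj_on c {..<s * m}"
    and c: "\<And>i. i < s * m \<Longrightarrow> c i < N" and x: "x < N" "x \<notin> c ` {..<s * m}"
    and cyc: "\<And>i. i < s * m \<Longrightarrow> \<not> E (c i) (c (Suc i mod (s * m)))"
    and spoke: "\<And>i. i < s * m \<Longrightarrow> s dvd i \<Longrightarrow> \<not> E x (c i)"
  shows "contains N (complement N E) (s * m + 1) (jahangir_edges s m)"
proof -
  let ?k = "s * m"
  define f where "f i = (if i = ?k then x else c i)" for i
  have inj': "inj_on f {0..<?k + 1}"
    using inj x(2) by (auto simp: f_def inj_on_def)
  have range: "f ` {0..<?k + 1} \<subseteq> {0..<N}" using c x(1) by (auto simp: f_def)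
  have cycle: "complement N E (c i) (c (Suc i mod ?k))" "complement N E (c (Suc i mod ?k)) (c i)"
    if i: "i < ?k" for i
  proof -
    have l: "Suc i mod ?k < ?k" by (rule mod_less_divisor) (use k in linarith)
    have "Suc i mod ?k \<noteq> i"
    proof (cases "Suc i = ?k")
      case True
      then have "Suc i mod ?k = 0" by simp
      then show ?thesis using True k by linarith
    next
      case False
      then show ?thesis using i by simp
    qed
    then have "c i \<noteq> c (Suc i mod ?k)"
      using inj_onD[OF inj, of i "Suc i mod ?k"] i l by auto
    then show "complement N E (c i) (c (Suc i mod ?k))" "complement N E (c (Suc i mod ?k)) (c i)"
      using cyc[OF i] c[OF i] c[OF l] sym by (auto simp: complement_def dest: sympD)
  qed
  have spokes: "complement N E x (c i)" "complement N E (c i) x" if "i < ?k" "s dvd i" for i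
    using spoke[OF that] c[OF that(1)] x sym that by (auto simp: complement_def dest: sympD)
  have "complement N E (f u) (f v)" if "u < ?k + 1" "v < ?k + 1" "jahangir_edges s m u v" for u v
    using that(3) unfolding jahangir_edges_def
  proof (elim disjE conjE)
    assume "u < ?k" "v < ?k" "v = (u + 1) mod ?k"
    then show ?thesis using cycle(1)[of u] by (simp add: f_def)
  next
    assume "u < ?k" "v < ?k" "u = (v + 1) mod ?k"
    then show ?thesis using cycle(2)[of v] by (simp add: f_def)
  next
    assume "u = ?k" "v < ?k" "s dvd v"
    then show ?thesis using spokes(1)[of v] by (simp add: f_def)
  next
    assume "v = ?k" "u < ?k" "s dvd u"
    then show ?thesis using spokes(2)[of u] by (simp add: f_def)
  qed
  then show ?thesis unfolding contains_def using inj' range by blast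
qed

lemma obtain_injection:
  assumes "finite A" "p \<le> card A"
  obtains a :: "nat \<Rightarrow> 'a" where "inj_on a {..<p}" "\<And>i. i < p \<Longrightarrow> a i \<in> A"
proof -
  obtain h where h: "bij_betw h {0..<card A} A" using ex_bij_betw_nat_finite[OF assms(1)] by blast
  have "inj_on h {..<p}" using h assms(2) by (auto simp: bij_betw_def inj_on_def)
  moreover have "h i \<in> A" if "i < p" for i
    using h assms(2) that by (auto simp: bij_betw_def)
  ultimately show ?thesis using that by blast
qed

text \<open>The cycle alternates between non-neighbours of \<open>x\<close> in \<open>S\<close> and
  in \<open>T\<close>, so each cycle edge crosses between the sides, and \<open>x\<close> can be
  joined to every cycle vertex.\<close>

lemma jahangir_of_hub_even:
  assumes sym: "symp E" and cf: "cross_free E S T" and S: "S \<subseteq> {0..<N}" and T: "T \<subseteq> {0..<N}"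
    and x: "x < N" and hub: "hub E p S T x" and k: "s * m = 2 * p" "0 < p"
  shows "contains N (complement N E) (s * m + 1) (jahangir_edges s m)"
proof -
  have fin: "finite (nonnbrs E x S)" "finite (nonnbrs E x T)"
    using S T by (auto simp: nonnbrs_def intro: finite_subset)
  obtain a where a: "inj_on a {..<p}" "\<And>i. i < p \<Longrightarrow> a i \<in> nonnbrs E x S"
    using obtain_injection[OF fin(1)] hub by (metis hub_def)
  obtain b where b: "inj_on b {..<p}" "\<And>i. i < p \<Longrightarrow> b i \<in> nonnbrs E x T"
    using obtain_injection[OF fin(2)] hub by (metis hub_def)
  define c where "c i = (if even i then a (i div 2) else b (i div 2))" for i
  have half: "i div 2 < p" if "i < s * m" for i using that k by auto
  have ca: "c i \<in> nonnbrs E x S" if "i < s * m" "even i" for i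
    using a(2)[OF half] that by (auto simp: c_def)
  have cb: "c i \<in> nonnbrs E x T" if "i < s * m" "odd i" for i
    using b(2)[OF half] that by (auto simp: c_def)
  have cab: "c i \<in> nonnbrs E x S \<union> nonnbrs E x T" if "i < s * m" for i
    using ca cb that by blast
  have ne: "\<not> E u v" "\<not> E v u" if "u \<in> S" "v \<in> T" for u v
    using cf that sym by (auto simp: cross_free_def dest: sympD)
  show ?thesis
  proof (rule contains_jahangir[OF sym, where c = c and x = x])
    show "2 \<le> s * m" using k by simp
    show "inj_on c {..<s * m}"
    proof (rule inj_onI)
      fix i j assume ij: "i \<in> {..<s * m}" "j \<in> {..<s * m}" "c i = c j"
      have par: "even i = even j"
        using ca[of i] ca[of j] cb[of i] cb[of j] ij cf
        by (auto simp: cross_free_def nonnbrs_def)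
      then have "i div 2 = j div 2"
        using ij half inj_onD[OF a(1), of "i div 2" "j div 2"] inj_onD[OF b(1), of "i div 2" "j div 2"]
        by (auto simp: c_def split: if_splits)
      then show "i = j" using par by (metis even_two_times_div_two odd_two_times_div_two_succ)
    qed
    show "c i < N" if "i < s * m" for i
      using cab[OF that] S T by (auto simp: nonnbrs_def)
    show "x < N" by (rule x)
    show "x \<notin> c ` {..<s * m}" using cab by (auto simp: nonnbrs_def)
    show "\<not> E x (c i)" if "i < s * m" for i
      using cab[OF that] by (auto simp: nonnbrs_def)
    show "\<not> E (c i) (c (Suc i mod (s * m)))" if i: "i < s * m" for i
    proof -
      have l: "Suc i mod (s * m) < s * m" by (rule mod_less_divisor) (use k in linarith)
      \<comment> \<open>As \<open>s * m\<close> is even, the alternation persists where the cycle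
        closes.\<close>
      have "even (Suc i mod (s * m)) \<longleftrightarrow> odd i" using k by (simp add: dvd_mod_iff)
      then show ?thesis using ca[OF i] cb[OF i] ca[OF l] cb[OF l] ne
        by (cases "even i") (auto simp: nonnbrs_def)
    qed
  qed
qed

text \<open>The cycle is embedded as \<open>b\<^sub>0, y, z, b\<^sub>1, a\<^sub>0, b\<^sub>2, a\<^sub>1, \<dots>\<close>. Since \<open>s \<ge> 3\<close>, the
  positions of \<open>y\<close> and \<open>z\<close> carry no spoke.\<close>
lemma jahangir_of_hub_odd:
  assumes sym: "symp E" and cf: "cross_free E S T" and S: "S \<subseteq> {0..<N}" and T: "T \<subseteq> {0..<N}"
    and x: "x < N" and hub: "hub E (Suc p) S T x" and k: "s * m = 2 * p + 1" "2 \<le> p" and s: "3 \<le> s"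
    and yz: "y \<in> S - {x}" "z \<in> S - {x}" "y \<noteq> z" "\<not> E y z"
  shows "contains N (complement N E) (s * m + 1) (jahangir_edges s m)"
proof -
  let ?A = "nonnbrs E x S - {y, z}"
  have fin: "finite (nonnbrs E x S)" "finite (nonnbrs E x T)"
    using S T by (auto simp: nonnbrs_def intro: finite_subset)
  \<comment> \<open>Even if both \<open>y\<close> and \<open>z\<close> are non-neighbours of
    \<open>x\<close>, there remain \<open>p - 1\<close> others, just enough for the even positions
    \<open>4, 6, ..., 2 * p\<close>.\<close>
  have "card (nonnbrs E x S) - card {y, z} \<le> card ?A" by (rule diff_card_le_card_Diff) simp
  moreover have "Suc p \<le> card (nonnbrs E x S)" using hub by (simp add: hub_def)
  ultimately have "p - 1 \<le> card ?A" using yz(3) by simp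
  then obtain a where a: "inj_on a {..<p - 1}" "\<And>i. i < p - 1 \<Longrightarrow> a i \<in> ?A"
    using obtain_injection[of ?A] fin by (metis finite_Diff)
  have "p \<le> card (nonnbrs E x T)" using hub by (simp add: hub_def)
  then obtain b where b: "inj_on b {..<p}" "\<And>i. i < p \<Longrightarrow> b i \<in> nonnbrs E x T"
    using obtain_injection[OF fin(2)] by metis
  \<comment> \<open>The edge from \<open>y\<close> to \<open>z\<close> inside \<open>S\<close>
    absorbs the odd length; all other cycle edges cross. Positions
    \<open>0, 3, 5, ..., 2 * p - 1\<close> use the indices \<open>0, ..., p - 1\<close> of
    \<open>b\<close>, and the even positions from 4 on use \<open>0, ..., p - 2\<close> of
    \<open>a\<close>.\<close>
  define c where "c i = (if i = 1 then y else if i = 2 then z else if i = 0 \<or> odd i then b (i div 2)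
    else a (i div 2 - 2))" for i
  have cb: "c i = b (i div 2)" "i div 2 < p" "c i \<in> nonnbrs E x T"
    if "i < s * m" "i = 0 \<or> odd i" "i \<noteq> 1" for i
  proof -
    show c: "c i = b (i div 2)" using that by (auto simp: c_def)
    show "i div 2 < p" using that k by (auto elim!: oddE)
    then show "c i \<in> nonnbrs E x T" using c b(2) by simp
  qed
  have ca: "c i = a (i div 2 - 2)" "i div 2 - 2 < p - 1" "c i \<in> ?A" "4 \<le> i"
    if "i < s * m" "even i" "i \<noteq> 0" "i \<noteq> 2" for i
  proof -
    show c: "c i = a (i div 2 - 2)" using that by (auto simp: c_def)
    show "4 \<le> i" using that by (auto elim!: evenE)
    then show "i div 2 - 2 < p - 1" using that k by auto
    then show "c i \<in> ?A" using c a(2) by metis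
  qed
  have c12: "c 1 = y" "c 2 = z" by (auto simp: c_def)
  have cases: "i = 1 \<or> i = 2 \<or> ((i = 0 \<or> odd i) \<and> i \<noteq> 1) \<or> (even i \<and> i \<noteq> 0 \<and> i \<noteq> 2)" for i :: nat
    by auto
  have ne: "\<not> E u v" "\<not> E v u" if "u \<in> S" "v \<in> T" for u v
    using cf that sym by (auto simp: cross_free_def dest: sympD)
  have inS: "c i \<in> S" if "i < s * m" "i = 1 \<or> (even i \<and> i \<noteq> 0)" for i
    using that c12 yz ca(3)[of i] by (cases "i = 2") (auto simp: nonnbrs_def)
  have inT: "c i \<in> T" if "i < s * m" "i \<noteq> 1" "odd i \<or> i = 0" for i
    using that cb(3)[of i] by (auto simp: nonnbrs_def)
  have disj: "S \<inter> T = {}" using cf by (simp add: cross_free_def)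
  show ?thesis
  proof (rule contains_jahangir[OF sym, where c = c and x = x])
    show "2 \<le> s * m" using k by simp
    show "inj_on c {..<s * m}"
    proof (rule inj_onI)
      fix i j assume "i \<in> {..<s * m}" "j \<in> {..<s * m}" and eq: "c i = c j"
      then have ij: "i < s * m" "j < s * m" by auto
      consider (S) "i = 1 \<or> (even i \<and> i \<noteq> 0)" "j = 1 \<or> (even j \<and> j \<noteq> 0)"
        | (T) "i \<noteq> 1" "odd i \<or> i = 0" "j \<noteq> 1" "odd j \<or> j = 0"
        using inS[OF ij(1)] inS[OF ij(2)] inT[OF ij(1)] inT[OF ij(2)] eq disj by fastforce
      then show "i = j"
      proof cases
        case T
        then have "b (i div 2) = b (j div 2)" using cb(1)[of i] cb(1)[of j] ij eq by metis
        then have "i div 2 = j div 2"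
          by (rule inj_onD[OF b(1)]) (use cb(2) ij T in auto)
        \<comment> \<open>Position 0 is the only even one filled from \<open>b\<close>; with
          position 1 excluded, no other such position has half 0.\<close>
        moreover have "i div 2 = 0 \<longleftrightarrow> i = 0" "j div 2 = 0 \<longleftrightarrow> j = 0" using T by auto
        ultimately show ?thesis using T by (metis odd_two_times_div_two_succ)
      next
        case S
        have yz_iff: "c l = y \<longleftrightarrow> l = 1" "c l = z \<longleftrightarrow> l = 2"
          if "l < s * m" "l = 1 \<or> (even l \<and> l \<noteq> 0)" for l
          using c12 yz(3) ca(3)[of l] that by (cases "l = 1"; cases "l = 2"; auto)+
        show ?thesis
        proof (cases "i \<in> {1, 2} \<or> j \<in> {1, 2}")
          case True
          then show ?thesis using yz_iff[of i] yz_iff[of j] S ij eq c12 by (metis insertE singletonD)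
        next
          case False
          then have ev: "even i" "even j" "i \<noteq> 0" "i \<noteq> 2" "j \<noteq> 0" "j \<noteq> 2" using S by auto
          have "a (i div 2 - 2) = a (j div 2 - 2)" using ca(1)[of i] ca(1)[of j] ij ev eq by metis
          then have "i div 2 - 2 = j div 2 - 2"
            by (rule inj_onD[OF a(1)]) (use ca(2) ij ev in auto)
          moreover have "4 \<le> i" "4 \<le> j" using ca(4) ij ev by auto
          ultimately have "i div 2 = j div 2" by linarith
          then show ?thesis using ev by (metis even_two_times_div_two)
        qed
      qed
    qed
    show "c i < N" if "i < s * m" for i
      using inS[OF that] inT[OF that] S T by fastforce
    show "x < N" by (rule x)
    have "c i \<noteq> x" if "i < s * m" for i
      using cases[of i] ca(3)[OF that] cb(3)[OF that] c12 yz by (auto simp: nonnbrs_def)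
    then show "x \<notin> c ` {..<s * m}" by auto
    show "\<not> E x (c i)" if "i < s * m" "s dvd i" for i
    proof -
      have "i \<noteq> 1" "i \<noteq> 2" using that s by (auto dest: dvd_imp_le)
      then show ?thesis using cases[of i] ca(3)[OF that(1)] cb(3)[OF that(1)]
        by (auto simp: nonnbrs_def)
    qed
    show "\<not> E (c i) (c (Suc i mod (s * m)))" if i: "i < s * m" for i
    proof -
      consider "Suc i = s * m" | "i = 0" | "i = 1" | "i = 2" | "3 \<le> i" "Suc i < s * m" "even i"
        | "3 \<le> i" "Suc i < s * m" "odd i"
        using i by linarith
      then show ?thesis
      proof cases
        case 1
        then have "i = 2 * p" using k by simp
        then show ?thesis using 1 inS[OF i] inT[of 0] ne k by auto
      next
        case 2
        then show ?thesis using inS[of 1] inT[of 0] ne k by auto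
      next
        case 3
        then show ?thesis using yz c12 k by (simp add: numeral_2_eq_2)
      next
        case 4
        then show ?thesis using inS[of 2] inT[of 3] ne k by auto
      next
        case 5
        then show ?thesis using inS[OF i] inT[of "Suc i"] ne by auto
      next
        case 6
        then show ?thesis using inS[of "Suc i"] inT[OF i] ne by auto
      qed
    qed
  qed
qed

section \<open>Lower-bound graphs\<close>

text \<open>Colours that agree along edges are constant along a path, so a path is no longer than
  the largest colour class.\<close>

lemma contains_path_monochromatic:
  assumes "contains N E n (path_edges n)" "\<And>u v. E u v \<Longrightarrow> C u = C v"
  obtains A where "card A = n" "A \<subseteq> {0..<N}" "\<And>u v. u \<in> A \<Longrightarrow> v \<in> A \<Longrightarrow> C u = C v"
proof -
  obtain f where f: "inj_on f {0..<n}" "f ` {0..<n} \<subseteq> {0..<N}"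
    "\<And>u v. u < n \<Longrightarrow> v < n \<Longrightarrow> path_edges n u v \<Longrightarrow> E (f u) (f v)"
    using assms(1) unfolding contains_def by auto
  have "C (f i) = C (f 0)" if "i < n" for i
    using that
  proof (induction i)
    case (Suc i)
    then have "E (f i) (f (Suc i))" by (intro f(3)) (auto simp: path_edges_def)
    then show ?case using assms(2) Suc by fastforce
  qed simp
  then have "C u = C v" if "u \<in> f ` {0..<n}" "v \<in> f ` {0..<n}" for u v
    using that by (metis (mono_tags) atLeastLessThan_iff imageE)
  moreover have "card (f ` {0..<n}) = n" using f(1) by (simp add: card_image)
  ultimately show ?thesis using that f(2) by blast
qed

text \<open>The induction step for parity along a walk in two colours: each move reverses whether
  the colour equals the reference colour.\<close>

lemma two_colour_flip:
  fixes a b c :: nat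
  assumes "a < 2" "b < 2" "c < 2" "a \<noteq> b"
  shows "(b = c) = (a \<noteq> c)"
  using assms by auto

text \<open>Closing an arc of the cycle between consecutive spokes through the centre gives an odd cycle
  of length \<open>s + 2\<close>.\<close>
lemma arc_meets_third_colour:
  fixes g :: "nat \<Rightarrow> nat"
  assumes "odd s" "\<And>i. g i \<noteq> g (Suc i)" "\<And>j. h \<noteq> g (j * s)" "h < 2" "\<And>i. g i \<le> 2"
  obtains i where "j * s \<le> i" "i \<le> Suc j * s" "g i = 2"
proof (rule ccontr)
  assume contra: "\<not> thesis"
  note found = that
  have two: "g i < 2" if "j * s \<le> i" "i \<le> Suc j * s" for i
  proof -
    have "g i \<noteq> 2" using found[OF that] contra by blast
    then show ?thesis using assms(5)[of i] by simp
  qed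
  \<comment> \<open>With two colours the arc alternates, so its ends differ as \<open>s\<close> is
    odd; but both ends avoid the colour \<open>h\<close> and hence agree.\<close>
  have alt: "i \<le> s \<Longrightarrow> (g (j * s + i) = g (j * s)) = even i" for i
  proof (induction i)
    case (Suc i)
    have "g (j * s + i) < 2" "g (j * s + Suc i) < 2" "g (j * s) < 2"
      by (rule two; use Suc.prems in simp)+
    then show ?case using two_colour_flip[of "g (j * s + i)" "g (j * s + Suc i)" "g (j * s)"] assms(2)[of "j * s + i"] Suc
      by simp
  qed simp
  have "g (j * s) < 2" "g (Suc j * s) < 2" by (rule two; simp)+
  then have "g (Suc j * s) = g (j * s)"
    using assms(3)[of j] assms(3)[of "Suc j"] assms(4) by linarith
  moreover have "Suc j * s = j * s + s" by simp
  ultimately show False using alt[of s] assms(1) by (simp add: add.commute)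
qed

text \<open>Colours 0 and 1 mark the two cliques; below \<open>2 * n - 1\<close>, colour 2 is left
  to the single vertex \<open>2 * n - 2\<close>.\<close>

definition lower_bound_colour :: "nat \<Rightarrow> nat \<Rightarrow> nat" where
  "lower_bound_colour n u = (if u < n - 1 then 0 else if u < 2 * n - 2 then 1 else 2)"

text \<open>Truncation at \<open>N\<close> lets one construction serve both parities of
  \<open>m\<close> and every smaller vertex count.\<close>

definition lower_bound_graph :: "nat \<Rightarrow> nat \<Rightarrow> nat \<Rightarrow> nat \<Rightarrow> bool" where
  "lower_bound_graph n N u v \<longleftrightarrow>
    u < N \<and> v < N \<and> u \<noteq> v \<and> lower_bound_colour n u = lower_bound_colour n v"

lemma lower_bound_graph_no_path:
  assumes "2 \<le> n" "N \<le> 2 * n - 1"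
  shows "\<not> contains N (lower_bound_graph n N) n (path_edges n)"
proof
  assume c: "contains N (lower_bound_graph n N) n (path_edges n)"
  have "lower_bound_colour n u = lower_bound_colour n v" if "lower_bound_graph n N u v" for u v
    using that by (simp add: lower_bound_graph_def)
  then obtain A where A: "card A = n" "A \<subseteq> {0..<N}"
    "\<And>u v. u \<in> A \<Longrightarrow> v \<in> A \<Longrightarrow> lower_bound_colour n u = lower_bound_colour n v"
    using contains_path_monochromatic[OF c, where C = "lower_bound_colour n"] by metis
  have "A \<noteq> {}" using A(1) assms(1) by auto
  then obtain u where u: "u \<in> A" by blast
  have mem: "v < N \<and> lower_bound_colour n v = lower_bound_colour n u" if "v \<in> A" for v
    using A(2) A(3)[OF that u] that by auto
  consider "lower_bound_colour n u = 0" | "lower_bound_colour n u = 1" | "lower_bound_colour n u = 2"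
    unfolding lower_bound_colour_def by presburger
  then have "A \<subseteq> {0..<n-1} \<or> A \<subseteq> {n-1..<2*n-2} \<or> A \<subseteq> {2*n-2}"
  proof cases
    case 1
    have "v < n - 1" if "v \<in> A" for v
    proof -
      have "v < N" "lower_bound_colour n v = 0" using mem[OF that] 1 by simp_all
      then show ?thesis using assms by (simp add: lower_bound_colour_def split: if_splits)
    qed
    then show ?thesis by auto
  next
    case 2
    have "n - 1 \<le> v \<and> v < 2 * n - 2" if "v \<in> A" for v
    proof -
      have "v < N" "lower_bound_colour n v = 1" using mem[OF that] 2 by simp_all
      then show ?thesis
        by (cases "v < n - 1"; cases "v < 2 * n - 2")
          (simp_all only: lower_bound_colour_def if_True if_False, simp_all)
    qed
    then show ?thesis by auto
  next
    case 3
    have "v = 2*n-2" if "v \<in> A" for v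
    proof -
      have "v < N" "lower_bound_colour n v = 2" using mem[OF that] 3 by simp_all
      then have "\<not> v < 2 * n - 2" by (auto simp only: lower_bound_colour_def split: if_splits)
      then show ?thesis using \<open>v < N\<close> assms by linarith
    qed
    then show ?thesis by blast
  qed
  then have "card A \<le> n - 1"
    using assms(1) by (auto dest!: card_mono[rotated])
  then show False using A(1) assms by simp
qed

text \<open>A vertex of the third colour can be the centre, leaving an odd cycle in two colours, or meet at
  most two of the first three arcs.\<close>
lemma lower_bound_graph_no_jahangir:
  assumes s: "odd s" and m: "2 \<le> m" and N: "N \<le> 2 * n - 1"
    and rare: "N \<le> 2 * n - 2 \<or> odd m \<and> 3 \<le> m"
  shows "\<not> contains N (complement N (lower_bound_graph n N)) (s * m + 1) (jahangir_edges s m)"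
proof
  let ?k = "s * m"
  assume "contains N (complement N (lower_bound_graph n N)) (?k + 1) (jahangir_edges s m)"
  then obtain f where f: "inj_on f {0..<?k + 1}" "f ` {0..<?k + 1} \<subseteq> {0..<N}"
    and e: "\<And>u v. u < ?k + 1 \<Longrightarrow> v < ?k + 1 \<Longrightarrow> jahangir_edges s m u v \<Longrightarrow>
      complement N (lower_bound_graph n N) (f u) (f v)"
    unfolding contains_def by auto
  define C where "C i = lower_bound_colour n (f i)" for i
  \<comment> \<open>The cycle colouring is continued periodically, so that arcs are intervals of
    natural numbers.\<close>
  define g where "g i = C (i mod ?k)" for i
  have s0: "0 < s" using s by (auto elim: oddE)
  have k0: "0 < ?k" using s0 m by simp
  have edge: "C u \<noteq> C v" if "u < ?k + 1" "v < ?k + 1" "jahangir_edges s m u v" for u v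
    using e[OF that] by (auto simp: C_def complement_def lower_bound_graph_def)
  have le2: "C i \<le> 2" for i by (simp add: C_def lower_bound_colour_def)
  \<comment> \<open>Only the vertex \<open>2 * n - 2\<close> can have colour 2, and it is present
    only if \<open>N\<close> exceeds \<open>2 * n - 2\<close>.\<close>
  have third: "i = j \<and> \<not> N \<le> 2 * n - 2" if "C i = 2" "C j = 2" "i \<le> ?k" "j \<le> ?k" for i j
  proof -
    have *: "f l = 2 * n - 2 \<and> f l < N" if "C l = 2" "l \<le> ?k" for l
    proof -
      have "f l < N" using f(2) that(2) by (force simp: image_subset_iff)
      then show ?thesis
        using that(1) N by (auto simp: C_def lower_bound_colour_def split: if_splits)
    qed
    have "f i = f j" using *[of i] *[of j] that by simp
    then have "i = j" using inj_onD[OF f(1)] that by simp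
    then show ?thesis using *[of i] that by simp
  qed
  have g_step: "g i \<noteq> g (Suc i)" for i
  proof -
    have l: "i mod ?k < ?k" "Suc i mod ?k < ?k" by (rule mod_less_divisor[OF k0])+
    have "Suc i mod ?k = (i mod ?k + 1) mod ?k" by (simp add: mod_Suc_eq)
    then have "jahangir_edges s m (i mod ?k) (Suc i mod ?k)"
      using l by (auto simp only: jahangir_edges_def)
    then show ?thesis unfolding g_def by (intro edge) (use l in linarith)+
  qed
  have g_spoke: "C ?k \<noteq> g (j * s)" for j
  proof -
    have l: "j * s mod ?k < ?k" by (rule mod_less_divisor[OF k0])
    have "s dvd j * s mod ?k" by (simp add: dvd_mod_iff)
    then have "jahangir_edges s m ?k (j * s mod ?k)"
      using l by (auto simp only: jahangir_edges_def)
    then show ?thesis unfolding g_def by (intro edge) (use l in linarith)+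
  qed
  have g2: "g i \<le> 2" for i using le2 by (simp add: g_def)
  have g_third: "i mod ?k = j mod ?k \<and> \<not> N \<le> 2 * n - 2" if "g i = 2" "g j = 2" for i j
    using third[of "i mod ?k" "j mod ?k"] that mod_less_divisor[OF k0] by (simp add: g_def less_imp_le)
  show False
  proof (cases "C ?k = 2")
    case True
    have "g i < 2" for i
    proof -
      have "i mod ?k < ?k" by (rule mod_less_divisor[OF k0])
      then have "g i \<noteq> 2" using third[of "i mod ?k" ?k] True by (auto simp: g_def)
      then show ?thesis using g2[of i] by simp
    qed
    have alt: "(g i = g 0) = even i" for i
    proof (induction i)
      case (Suc i)
      then show ?case using two_colour_flip[of "g i" "g (Suc i)" "g 0"] g_step[of i] \<open>\<And>i. g i < 2\<close> by simp
    qed simp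
    have "g ?k = g 0" by (simp add: g_def)
    then have "even ?k" using alt by simp
    moreover have "odd m" using third[of ?k ?k] True rare by auto
    ultimately show False using s by simp
  next
    case False
    then have h: "C ?k < 2" using le2[of ?k] by simp
    note arc = arc_meets_third_colour[OF s g_step g_spoke h g2]
    obtain i0 where i0: "0 * s \<le> i0" "i0 \<le> Suc 0 * s" "g i0 = 2" by (rule arc)
    obtain i1 where i1: "1 * s \<le> i1" "i1 \<le> Suc 1 * s" "g i1 = 2" by (rule arc)
    obtain i2 where i2: "2 * s \<le> i2" "i2 \<le> Suc 2 * s" "g i2 = 2" by (rule arc)
    \<comment> \<open>A vertex of colour 2 rules out the first alternative of \<open>rare\<close>.
      The three positions found coincide modulo \<open>s * m\<close>; the first two arcs share only
      position \<open>s\<close>, whereas the third runs from \<open>2 * s\<close> to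
      \<open>3 * s\<close>, whose end becomes 0 if \<open>m = 3\<close>.\<close>
    have m3: "3 \<le> m" using g_third[OF i0(3) i0(3)] rare by auto
    have k3: "3 * s \<le> ?k" using mult_le_mono1[OF m3, of s] by (simp only: mult.commute)
    have "i0 \<le> s" "i1 \<le> 2 * s" using i0(2) i1(2) by simp_all
    then have "i0 < ?k" "i1 < ?k" using s0 k3 by linarith+
    then have small: "i0 mod ?k = i0" "i1 mod ?k = i1" by (simp_all only: mod_less)
    then have "i0 = i1" using g_third[OF i0(3) i1(3)] by metis
    then have i0s: "i0 = s" using i0(2) i1(1) by simp
    have "i2 mod ?k = s" using g_third[OF i0(3) i2(3)] small(1) i0s by metis
    moreover have "i2 mod ?k = i2 \<or> i2 mod ?k = 0"
    proof (cases "i2 = ?k")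
      case True
      then show ?thesis by simp
    next
      case False
      have "i2 \<le> 3 * s" using i2(2) by simp
      then have "i2 < ?k" using False k3 by linarith
      then have "i2 mod ?k = i2" by (rule mod_less)
      then show ?thesis by blast
    qed
    moreover have "2 * s \<le> i2" by (rule i2(1))
    ultimately show False using s0 by linarith
  qed
qed

section \<open>The Ramsey numbers\<close>

lemma ramsey_eqI:
  assumes "\<And>E. simple_graph N E \<Longrightarrow> contains N E kG GE \<or> contains N (complement N E) kH HE"
    and "\<And>M. M < N \<Longrightarrow> \<exists>E. simple_graph M E \<and> \<not> contains M E kG GE \<and> \<not> contains M (complement M E) kH HE"
  shows "ramsey kG GE kH HE = N"
  unfolding ramsey_def
proof (rule Least_equality)
  show "\<forall>E. simple_graph N E \<longrightarrow> contains N E kG GE \<or> contains N (complement N E) kH HE"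
    using assms(1) by blast
  show "N \<le> M" if "\<forall>E. simple_graph M E \<longrightarrow> contains M E kG GE \<or> contains M (complement M E) kH HE" for M
    using assms(2)[of M] that by (meson not_less)
qed

lemma simple_lower_bound_graph: "simple_graph N (lower_bound_graph n N)"
  by (auto simp: simple_graph_def lower_bound_graph_def)

lemma path_freeI:
  assumes "simple_graph N E" "\<not> contains N E n (path_edges n)"
  shows "path_free E {0..<N} n"
proof
  show sym: "symp E" using assms(1) by (auto simp: simple_graph_def intro: sympI)
  show "length xs < n" if "path_in E {0..<N} xs" for xs
    using contains_path[OF sym that] assms(2) by (meson not_less)
qed simp

lemma ramsey_even:
  assumes s: "3 \<le> s" "odd s" and m: "2 \<le> m" "even m" and n: "s * m * (s * m - 2) \<le> 2 * n"
  shows "ramsey n (path_edges n) (s * m + 1) (jahangir_edges s m) = 2 * n - 1"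
proof (rule ramsey_eqI)
  obtain p where p: "s * m = 2 * p" using m(2) by (metis dvd_mult evenE)
  have "3 * 2 \<le> s * m" by (rule mult_le_mono[OF s(1) m(1)])
  then have p3: "3 \<le> p" using p by simp
  \<comment> \<open>Here \<open>s * m - 2 = 2 * p - 2\<close> is at least 4. On
    \<open>2 * n - 1\<close> vertices \<open>hub_exists\<close> asks for
    \<open>4 * p \<le> n + 1\<close>.\<close>
  have "2 * p * 4 \<le> s * m * (s * m - 2)" unfolding p by (rule mult_le_mono) (use p3 in auto)
  then have n4: "4 * p \<le> n" using n by linarith
  show "contains (2 * n - 1) E n (path_edges n) \<or>
    contains (2 * n - 1) (complement (2 * n - 1) E) (s * m + 1) (jahangir_edges s m)"
    if E: "simple_graph (2 * n - 1) E" for E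
  proof (rule disj_imp[THEN iffD2, rule_format])
    assume "\<not> contains (2 * n - 1) E n (path_edges n)"
    then interpret path_free E "{0..<2 * n - 1}" n by (rule path_freeI[OF E])
    have q: "4 * p + n \<le> card {0..<2 * n - 1} + 2" "0 < p" "2 * n \<le> Suc (card {0..<2 * n - 1})"
      using n4 p3 by auto
    obtain S T x where "cross_free E S T" "S \<subseteq> {0..<2 * n - 1}" "T \<subseteq> {0..<2 * n - 1}"
      "x \<in> {0..<2 * n - 1}" "hub E p S T x"
      by (rule hub_exists[OF q])
    then show "contains (2 * n - 1) (complement (2 * n - 1) E) (s * m + 1) (jahangir_edges s m)"
      using jahangir_of_hub_even[OF sym _ _ _ _ _ p q(2)] by simp
  qed
  show "\<exists>E. simple_graph M E \<and> \<not> contains M E n (path_edges n) \<and>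
    \<not> contains M (complement M E) (s * m + 1) (jahangir_edges s m)" if "M < 2 * n - 1" for M
  proof -
    \<comment> \<open>With at most \<open>2 * n - 2\<close> vertices the isolated third-colour
      vertex is absent, the first alternative of \<open>rare\<close>.\<close>
    have "M \<le> 2 * n - 2" "M \<le> 2 * n - 1" "2 \<le> n" using that n4 p3 by auto
    then show ?thesis
      using lower_bound_graph_no_path lower_bound_graph_no_jahangir[OF s(2) m(1)]
        simple_lower_bound_graph by blast
  qed
qed

lemma ramsey_odd:
  assumes s: "3 \<le> s" "odd s" and m: "3 \<le> m" "odd m" and n: "(s * m - 1) * (s * m - 1) \<le> 2 * n"
  shows "ramsey n (path_edges n) (s * m + 1) (jahangir_edges s m) = 2 * n"
proof (rule ramsey_eqI)
  obtain p where p: "s * m = 2 * p + 1" using s(2) m(2) by (metis even_mult_iff oddE)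
  have "3 * 3 \<le> s * m" by (rule mult_le_mono[OF s(1) m(1)])
  then have p4: "4 \<le> p" using p by simp
  have "2 * p * 8 \<le> (s * m - 1) * (s * m - 1)" unfolding p by (rule mult_le_mono) (use p4 in auto)
  then have n8: "8 * p \<le> n" using n by linarith
  show "contains (2 * n) E n (path_edges n) \<or>
    contains (2 * n) (complement (2 * n) E) (s * m + 1) (jahangir_edges s m)"
    if E: "simple_graph (2 * n) E" for E
  proof (rule disj_imp[THEN iffD2, rule_format])
    assume "\<not> contains (2 * n) E n (path_edges n)"
    then interpret path_free E "{0..<2 * n}" n by (rule path_freeI[OF E])
    \<comment> \<open>The threshold is \<open>p + 1\<close> because \<open>y\<close> and
      \<open>z\<close> may use up two non-neighbours of the hub in \<open>S\<close>. The size
      condition amounts to \<open>4 * p + 4 \<le> n\<close>.\<close>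
    have q: "4 * Suc p + 2 + n \<le> card {0..<2 * n} + 2" "0 < Suc p" "2 * n \<le> card {0..<2 * n}"
      using n8 p4 by auto
    obtain S T x y z where "cross_free E S T" "S \<subseteq> {0..<2 * n}" "T \<subseteq> {0..<2 * n}"
      "x \<in> {0..<2 * n}" "hub E (Suc p) S T x" "y \<in> S - {x}" "z \<in> S - {x}" "y \<noteq> z" "\<not> E y z"
      by (rule hub_with_nonadjacent_pair[OF q])
    then show "contains (2 * n) (complement (2 * n) E) (s * m + 1) (jahangir_edges s m)"
      using jahangir_of_hub_odd[OF sym _ _ _ _ _ p _ s(1)] p4 by simp
  qed
  show "\<exists>E. simple_graph M E \<and> \<not> contains M E n (path_edges n) \<and>
    \<not> contains M (complement M E) (s * m + 1) (jahangir_edges s m)" if "M < 2 * n" for M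
  proof -
    \<comment> \<open>Now the isolated vertex may occur; \<open>m\<close> being odd gives the second
      alternative of \<open>rare\<close>.\<close>
    have "M \<le> 2 * n - 1" "2 \<le> n" "2 \<le> m" using that n8 p4 m by auto
    then show ?thesis
      using lower_bound_graph_no_path lower_bound_graph_no_jahangir[OF s(2)] m
        simple_lower_bound_graph by blast
  qed
qed

theorem theorem2:
  fixes s m n :: nat
  assumes "s \<ge> 3" and "odd s"
  shows "(m \<ge> 2 \<and> even m \<and> 2 * n \<ge> s * m * (s * m - 2)
            \<longrightarrow> ramsey n (path_edges n) (s * m + 1) (jahangir_edges s m) = 2 * n - 1)
       \<and> (m \<ge> 3 \<and> odd m \<and> 2 * n \<ge> (s * m - 1) * (s * m - 1)
            \<longrightarrow> ramsey n (path_edges n) (s * m + 1) (jahangir_edges s m) = 2 * n)"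
  using ramsey_even[OF assms] ramsey_odd[OF assms] by blast

end
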